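(* Let $A$ be a symmetric real $p\times p$ matrix and $B$ a symmetric positive definite real $p\times p$ matrix. Let $k, \mathsf{m}_1, j, \tilde j$ be positive integers with $k \le \mathsf{m}_1 \le j < \tilde j \le p$, and let $\mathcal U_j \subset \mathcal U_{\tilde j}$ be subspaces of $\mathbb R^p$ of dimensions $j$ and $\tilde j$, respectively. Then \[ \max_{V\subset\mathcal U_{j},\ V^TV = I_k}\rho(V) \;\le\; \max_{V\subset\mathcal U_{\tilde j},\ V^TV = I_k}\rho(V). \]
   Context: For a $p\times k$ real matrix $V$ with orthonormal columns ($V^TV=I_k$), the trace ratio is $\rho(V) = \operatorname{tr}(V^TAV)/\operatorname{tr}(V^TBV)$. For a subspace $\mathcal U$ of $\mathbb R^p$, the notation $V\subset\mathcal U$ means that all columns of the $p\times k$ matrix $V$ lie in $\mathcal U$. *)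

theory Defs
  imports "HOL-Analysis.Analysis"
begin

text \<open>A \<open>p \<times> k\<close> real matrix has type \<open>real^'k^'p\<close> (rows indexed by \<open>'p\<close>, columns by \<open>'k\<close>),
  so that \<open>p = CARD('p)\<close> and \<open>k = CARD('k)\<close>.\<close>

definition symmetric_matrix :: "real^'p^'p \<Rightarrow> bool" where
  "symmetric_matrix A \<longleftrightarrow> transpose A = A"

definition positive_definite :: "real^'p^'p \<Rightarrow> bool" where
  "positive_definite B \<longleftrightarrow> (\<forall>x. x \<noteq> 0 \<longrightarrow> x \<bullet> (B *v x) > 0)"

definition trace_ratio :: "real^'p^'p \<Rightarrow> real^'p^'p \<Rightarrow> real^'k^'p \<Rightarrow> real" where
  "trace_ratio A B V =
     trace (transpose V ** A ** V) / trace (transpose V ** B ** V)"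

definition orthonormal_frames_in :: "(real^'p) set \<Rightarrow> (real^'k^'p) set" where
  "orthonormal_frames_in U = {V. columns V \<subseteq> U \<and> transpose V ** V = mat 1}"

end

theory Submission
  imports Defs
begin

text \<open>The orthonormal frames in a subspace form a compact set (a Stiefel manifold), nonempty as
  soon as the dimension is at least \<open>k\<close>, and the trace ratio is continuous there because the
  denominator is positive; so both maxima exist, and enlarging the feasible set can only increase
  the maximum.\<close>

lemma transpose_mult_component:
  fixes V :: "real^'k^'p"
  shows "(transpose V ** V) $ a $ b = column a V \<bullet> column b V"
  by (simp add: matrix_matrix_mult_def transpose_def column_def inner_vec_def)

text \<open>The column form of membership: bounds, closedness and the construction of a frame are
  all read off from single columns and their inner products.\<close>

lemma orthonormal_frames_in_iff:
  fixes V :: "real^'k^'p"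
  shows "V \<in> orthonormal_frames_in U \<longleftrightarrow>
    (\<forall>a. column a V \<in> U) \<and> (\<forall>a b. column a V \<bullet> column b V = (if a = b then 1 else 0))"
proof -
  have "transpose V ** V = mat 1 \<longleftrightarrow>
      (\<forall>a b. column a V \<bullet> column b V = (if a = b then 1 else 0))"
    by (auto simp: vec_eq_iff transpose_mult_component mat_def)
  then show ?thesis
    by (auto simp: orthonormal_frames_in_def columns_def)
qed

text \<open>Each diagonal entry of the congruence is the quadratic form of \<open>B\<close> at one
  column, so continuity and positivity can be checked summand by summand.\<close>

lemma trace_congruence:
  fixes V :: "real^'k^'p" and B :: "real^'p^'p"
  shows "trace (transpose V ** B ** V) = (\<Sum>a\<in>UNIV. column a V \<bullet> (B *v column a V))"
proof -
  have "(transpose V ** (B ** V)) $ a $ a = column a V \<bullet> (B *v column a V)" for a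
    by (simp add: matrix_matrix_mult_def matrix_vector_mult_def transpose_def column_def
        inner_vec_def)
  then show ?thesis
    by (simp add: trace_def matrix_mul_assoc)
qed

lemma continuous_on_column [continuous_intros]:
  fixes V :: "'a::topological_space \<Rightarrow> real^'k^'p"
  assumes "continuous_on S V"
  shows "continuous_on S (\<lambda>x. column a (V x))"
  unfolding column_def by (intro continuous_intros assms)

lemma continuous_on_trace_congruence:
  fixes B :: "real^'p^'p"
  shows "continuous_on S (\<lambda>V :: real^'k^'p. trace (transpose V ** B ** V))"
  unfolding trace_congruence
  by (intro continuous_intros
      linear_continuous_on_compose[OF _ matrix_vector_mul_linear])

lemma trace_congruence_pos:
  fixes V :: "real^'k^'p" and B :: "real^'p^'p"
  assumes "positive_definite B" and "V \<in> orthonormal_frames_in U"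
  shows "0 < trace (transpose V ** B ** V)"
  unfolding trace_congruence
proof (rule sum_pos)
  fix a
  \<comment> \<open>A zero column would have inner product 0 with itself, whereas orthonormality
    makes it 1.\<close>
  have "column a V \<noteq> 0"
    using assms(2) by (metis inner_zero_left orthonormal_frames_in_iff zero_neq_one)
  then show "0 < column a V \<bullet> (B *v column a V)"
    using assms(1) by (simp add: positive_definite_def)
qed auto

lemma continuous_on_trace_ratio:
  fixes A B :: "real^'p^'p"
  assumes "positive_definite B"
  shows "continuous_on (orthonormal_frames_in U) (trace_ratio A B :: real^'k^'p \<Rightarrow> real)"
  unfolding trace_ratio_def
  using trace_congruence_pos[OF assms]
  by (intro continuous_on_divide continuous_on_trace_congruence) fastforce

text \<open>Heine-Borel: unit columns bound every entry, and the defining conditions are closed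
  conditions on continuous functions of \<open>V\<close>.\<close>

lemma compact_orthonormal_frames_in:
  assumes "closed U"
  shows "compact (orthonormal_frames_in U :: (real^'k^'p) set)"
  unfolding compact_eq_bounded_closed
proof
  have bound: "\<bar>V $ i $ a\<bar> \<le> 1" if "V \<in> orthonormal_frames_in U" for V :: "real^'k^'p" and i a
  proof -
    have "norm (column a V) = 1"
      using that by (simp add: orthonormal_frames_in_iff norm_eq_1)
    then show ?thesis
      using component_le_norm_cart[of "column a V" i] by (simp add: column_def)
  qed
  \<comment> \<open>A crude bound independent of \<open>V\<close> suffices: the norm is at most the
    sum of the row norms, and each row norm at most the sum of its absolute entries.\<close>
  have "norm V \<le> (\<Sum>i\<in>(UNIV :: 'p set). \<Sum>a\<in>(UNIV :: 'k set). 1)"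
    if "V \<in> orthonormal_frames_in U" for V :: "real^'k^'p"
  proof -
    have "norm V \<le> (\<Sum>i\<in>UNIV. norm (V $ i))"
      unfolding norm_vec_def by (rule L2_set_le_sum) simp
    also have "\<dots> \<le> (\<Sum>i\<in>(UNIV :: 'p set). \<Sum>a\<in>(UNIV :: 'k set). 1)"
      by (intro sum_mono order_trans[OF norm_le_l1_cart]) (use bound that in auto)
    finally show ?thesis .
  qed
  then show "bounded (orthonormal_frames_in U :: (real^'k^'p) set)"
    by (rule boundedI)
  \<comment> \<open>Preimages of the closed set \<open>U\<close> under the column maps, intersected
    with level sets of continuous inner products.\<close>
  have "orthonormal_frames_in U = (\<Inter>a. (column a :: real^'k^'p \<Rightarrow> _) -` U) \<inter>
      (\<Inter>a. \<Inter>b. {V. column a V \<bullet> column b V = (if a = b then 1 else 0)})"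
    by (auto simp: orthonormal_frames_in_iff)
  moreover have "closed \<dots>"
    by (intro closed_Int closed_INT ballI closed_vimage closed_Collect_eq continuous_intros assms)
  ultimately show "closed (orthonormal_frames_in U :: (real^'k^'p) set)"
    by simp
qed

text \<open>An orthonormal basis of \<open>U\<close> has at least \<open>CARD('k)\<close> elements,
  so distinct basis vectors can be chosen as columns.\<close>

lemma orthonormal_frames_in_nonempty:
  fixes U :: "(real^'p) set"
  assumes "subspace U" and "CARD('k::finite) \<le> dim U"
  shows "(orthonormal_frames_in U :: (real^'k^'p) set) \<noteq> {}"
proof -
  obtain E where E: "E \<subseteq> U" "pairwise orthogonal E" "\<And>x. x \<in> E \<Longrightarrow> norm x = 1"
    "independent E" "card E = dim U"
    using orthonormal_basis_subspace[OF assms(1)] by metis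
  obtain f :: "'k \<Rightarrow> real^'p" where f: "range f \<subseteq> E" "inj f"
    using card_le_inj[of "UNIV :: 'k set" E] E assms(2) independent_imp_finite by auto
  have "f a \<bullet> f b = (if a = b then 1 else 0)" for a b
  proof -
    have "f a \<in> E" "f b \<in> E"
      using f(1) by auto
    \<comment> \<open>Injectivity of \<open>f\<close> sends distinct indices to distinct, hence
      orthogonal, basis vectors; equal indices give a unit vector.\<close>
    then show ?thesis
      using f(2) E(2,3) by (auto simp: pairwise_def orthogonal_def inj_eq norm_eq_1[symmetric])
  qed
  moreover have "column a (\<chi> i b. f b $ i) = f a" for a
    by (simp add: column_def vec_eq_iff)
  ultimately have "(\<chi> i a. f a $ i) \<in> orthonormal_frames_in U"
    using subset_trans[OF f(1) E(1)] by (auto simp: orthonormal_frames_in_iff)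
  then show ?thesis
    by blast
qed

text \<open>Extreme value theorem; a subspace of a finite-dimensional space is closed, which gives
  compactness of the frames.\<close>

lemma trace_ratio_arg_max_exists:
  fixes A B :: "real^'p^'p"
  assumes "positive_definite B" and "subspace U" and "CARD('k::finite) \<le> dim U"
  obtains V :: "real^'k^'p"
  where "is_arg_max (trace_ratio A B) (\<lambda>W. W \<in> orthonormal_frames_in U) V"
proof -
  obtain V :: "real^'k^'p" where "V \<in> orthonormal_frames_in U"
    "\<forall>W :: real^'k^'p \<in> orthonormal_frames_in U. trace_ratio A B W \<le> trace_ratio A B V"
    using continuous_attains_sup
          [OF compact_orthonormal_frames_in[OF closed_subspace[OF assms(2)]]
        orthonormal_frames_in_nonempty[OF assms(2,3)] continuous_on_trace_ratio[OF assms(1)]]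
    by blast
  then show ?thesis
    by (intro that) (auto simp: is_arg_max_def not_less)
qed

lemma orthonormal_frames_in_mono:
  "U \<subseteq> U' \<Longrightarrow> orthonormal_frames_in U \<subseteq> orthonormal_frames_in U'"
  by (auto simp: orthonormal_frames_in_def)

text \<open>Expressing the maxima through maximisers makes their existence part of the claim. All
  maximisers over one set share the same value, so the inequality does not depend on the
  witnesses.\<close>

theorem proposition4:
  fixes A B :: "real^'p^'p"
    and U U' :: "(real^'p) set"
    and m1 j j' :: nat
  assumes "symmetric_matrix A"
    and "symmetric_matrix B" and "positive_definite B"
    and "0 < m1" and "0 < j" and "0 < j'"
    and "CARD('k::finite) \<le> m1" and "m1 \<le> j" and "j < j'" and "j' \<le> CARD('p)"
    and "subspace U" and "dim U = j"
    and "subspace U'" and "dim U' = j'"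
    and "U \<subseteq> U'"
  shows "\<exists>(V :: real^'k^'p) (V' :: real^'k^'p).
           is_arg_max (trace_ratio A B) (\<lambda>W. W \<in> orthonormal_frames_in U) V \<and>
           is_arg_max (trace_ratio A B) (\<lambda>W. W \<in> orthonormal_frames_in U') V' \<and>
           trace_ratio A B V \<le> trace_ratio A B V'"
proof -
  have "CARD('k) \<le> dim U" "CARD('k) \<le> dim U'"
    using assms by linarith+
  then obtain V V' :: "real^'k^'p"
    where V: "is_arg_max (trace_ratio A B) (\<lambda>W. W \<in> orthonormal_frames_in U) V"
      and V': "is_arg_max (trace_ratio A B) (\<lambda>W. W \<in> orthonormal_frames_in U') V'"
    using trace_ratio_arg_max_exists \<open>positive_definite B\<close> \<open>subspace U\<close> \<open>subspace U'\<close> by metis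
  \<comment> \<open>The maximiser over the smaller subspace competes in the larger one.\<close>
  have "V \<in> orthonormal_frames_in U'"
    using V orthonormal_frames_in_mono[OF \<open>U \<subseteq> U'\<close>] by (auto simp: is_arg_max_def)
  then have "trace_ratio A B V \<le> trace_ratio A B V'"
    using V' by (auto simp: is_arg_max_def not_less)
  with V V' show ?thesis
    by blast
qed

end
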